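(* Let $q=p^e>4$, where $p$ is a prime, and let $\ell$ be a positive integer with $2\ell\mid e$. Let $$k=\xi+1+\frac{q-1}{p^\ell+1},\qquad 0\le \xi\le\min\left\{1,\left\lfloor\frac{q-1}{p^\ell(p^\ell+1)}\right\rfloor\right\},$$ with $\xi$ an integer. Then there exists a $[q+2,k,q-k+2]_q$ AMDS code with a $(k-1)$-dimensional $\ell$-Galois hull. This code is also NMDS.
   Context: For $0\le\ell\le e-1$, the $\ell$-Galois inner product on $\mathbb F_q^N$ is $\langle\boldsymbol x,\boldsymbol y\rangle_\ell=\sum_i x_iy_i^{p^\ell}$; for a linear code $C\subseteq\mathbb F_q^N$, $C^{\perp_\ell}=\{\boldsymbol x:\langle\boldsymbol c,\boldsymbol x\rangle_\ell=0\ \forall\boldsymbol c\in C\}$ and the $\ell$-Galois hull is $C\cap C^{\perp_\ell}$. An $[N,k,d]_q$ code is a $k$-dimensional subspace of $\mathbb F_q^N$ with minimum Hamming distance $d$; it is AMDS if $d=N-k$, and NMDS if both it and its Euclidean dual are AMDS. *)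

theory Defs
  imports "HOL-Analysis.Cartesian_Space" "HOL-Computational_Algebra.Primes"
begin

text \<open>
  The field \<open>F\<^sub>q\<close> is a finite field type \<open>'a\<close> and \<open>F\<^sub>q\<^sup>N\<close> is the type \<open>'a ^ 'n\<close>, so that
  \<open>q = CARD('a)\<close> and \<open>N = CARD('n)\<close>.
\<close>

definition hamming_dist :: "'a ^ 'n \<Rightarrow> 'a ^ 'n \<Rightarrow> nat" where
  "hamming_dist x y = card {i. x $ i \<noteq> y $ i}"

text \<open>The value on a code with at most one word is \<open>Inf {} = 0\<close>.\<close>

definition min_dist :: "('a ^ 'n) set \<Rightarrow> nat" where
  "min_dist C = Inf {hamming_dist x y | x y. x \<in> C \<and> y \<in> C \<and> x \<noteq> y}"

definition linear_code :: "nat \<Rightarrow> nat \<Rightarrow> nat \<Rightarrow> nat \<Rightarrow> ('a::{field,finite} ^ 'n) set \<Rightarrow> bool" where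
  "linear_code N k d q C \<longleftrightarrow>
     CARD('n) = N \<and> CARD('a) = q \<and> vec.subspace C \<and> vec.dim C = k \<and> min_dist C = d"

definition euclidean_dual :: "('a::{field,finite} ^ 'n) set \<Rightarrow> ('a ^ 'n) set" where
  "euclidean_dual C = {x. \<forall>c\<in>C. (\<Sum>i\<in>UNIV. c $ i * x $ i) = 0}"

text \<open>The argument \<open>p\<close> is the characteristic of the field.\<close>

definition galois_inner :: "nat \<Rightarrow> nat \<Rightarrow> 'a::{field,finite} ^ 'n \<Rightarrow> 'a ^ 'n \<Rightarrow> 'a" where
  "galois_inner p l x y = (\<Sum>i\<in>UNIV. x $ i * (y $ i) ^ (p ^ l))"

definition galois_dual :: "nat \<Rightarrow> nat \<Rightarrow> ('a::{field,finite} ^ 'n) set \<Rightarrow> ('a ^ 'n) set" where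
  "galois_dual p l C = {x. \<forall>c\<in>C. galois_inner p l c x = 0}"

definition galois_hull :: "nat \<Rightarrow> nat \<Rightarrow> ('a::{field,finite} ^ 'n) set \<Rightarrow> ('a ^ 'n) set" where
  "galois_hull p l C = C \<inter> galois_dual p l C"

text \<open>The subtraction does not truncate, since \<open>vec.dim C \<le> CARD('n)\<close>.\<close>

definition AMDS :: "('a::{field,finite} ^ 'n) set \<Rightarrow> bool" where
  "AMDS C \<longleftrightarrow> vec.subspace C \<and> min_dist C = CARD('n) - vec.dim C"

definition NMDS :: "('a::{field,finite} ^ 'n) set \<Rightarrow> bool" where
  "NMDS C \<longleftrightarrow> AMDS C \<and> AMDS (euclidean_dual C)"

end

theory Submission
  imports Defs "HOL-Computational_Algebra.Polynomial"
begin

text \<open>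
  Let \<open>Q = p\<^sup>l\<close> and \<open>t = (q - 1) / (Q + 1)\<close>. The code encodes a polynomial \<open>f\<close> of degree less than \<open>k\<close>
  by its values on \<open>F\<^sub>q\<close>, its value at infinity \<open>f\<^bsub>k-1\<^esub>\<close> and the tangent coordinate \<open>f\<^bsub>k-2\<^esub>\<close>.
  Since a power sum over \<open>F\<^sub>q\<close> vanishes unless its exponent is a positive multiple of
  \<open>q - 1 = t (Q + 1)\<close>, the \<open>l\<close>-Galois form of the first \<open>q\<close> coordinates is \<open>- f\<^sub>t g\<^sub>t\<^sup>Q\<close> if \<open>\<xi> = 0\<close> and
  \<open>- f\<^sub>t g\<^sub>t\<^sup>Q - f\<^bsub>t-Q\<^esub> g\<^bsub>t+1\<^esub>\<^sup>Q\<close> if \<open>\<xi> = 1\<close>. One of the two additional coordinates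
  cancels the first summand, and what remains has rank one.

  The bounds \<open>d \<ge> q + 2 - k\<close> for the code and \<open>d \<ge> k\<close> for its dual come from counting roots. They are
  attained because the \<open>k - 1\<close> roots of \<open>x\<^sup>\<xi> (x\<^sup>t - 1)\<close> lie in \<open>F\<^sub>q\<close> and have sum zero. This needs
  \<open>t > 1\<close>, which is where \<open>q > 4\<close> enters.
\<close>

section \<open>Sums and cardinalities over an option type\<close>

lemma sum_UNIV_option:
  fixes F :: "'b::finite option \<Rightarrow> 'c::comm_monoid_add"
  shows "sum F UNIV = F None + (\<Sum>x\<in>UNIV. F (Some x))"
  by (simp add: UNIV_option_conv sum.reindex)

lemma card_Collect_option:
  "card {y::'b::finite option. P y} = (if P None then 1 else 0) + card {x. P (Some x)}"
proof -
  have "card {y. P y} = (\<Sum>y\<in>UNIV. if P y then 1 else 0)"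
    by (simp flip: sum.inter_filter)
  also have "\<dots> = (if P None then 1 else 0) + card {x. P (Some x)}"
    by (subst sum_UNIV_option) (simp flip: sum.inter_filter)
  finally show ?thesis .
qed

section \<open>Roots of unity and power sums in a finite field\<close>

lemma of_nat_CARD_eq_0: "of_nat CARD('a) = (0::'a::{ring_1,finite})"
proof -
  have "(\<Sum>x\<in>UNIV. x) = (\<Sum>x\<in>UNIV. x + (1::'a))"
    by (rule sum.reindex_bij_witness[of _ "\<lambda>x. x + 1" "\<lambda>x. x - 1"]) auto
  thus ?thesis
    by (simp add: sum.distrib)
qed

lemma CHAR_eq_prime_of_CARD:
  assumes "prime p" "CARD('a::{field,finite}) = p ^ e"
  shows "CHAR('a) = p"
proof -
  have "prime CHAR('a)"
    using finite_imp_CHAR_pos[where ?'a='a] prime_CHAR_semidom[where ?'a='a] by simp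
  moreover have "CHAR('a) dvd p ^ e"
    using of_nat_CARD_eq_0[where ?'a='a] of_nat_eq_0_iff_char_dvd[where ?'a='a] assms(2) by metis
  ultimately show ?thesis
    using assms(1) by (metis prime_dvd_power primes_dvd_imp_eq)
qed

lemma one_less_CARD: "1 < CARD('a::{zero_neq_one,finite})"
  using card_mono[of UNIV "{0,1::'a}"] by simp

lemma power_CARD_minus_1:
  fixes x :: "'a::{field,finite}"
  assumes "x \<noteq> 0"
  shows "x ^ (CARD('a) - 1) = 1"
proof -
  have "(\<Prod>y\<in>UNIV-{0}. x * y) = (\<Prod>y\<in>UNIV-{0}. y)"
    by (rule prod.reindex_bij_witness[of _ "\<lambda>y. y / x" "\<lambda>y. x * y"]) (use assms in auto)
  hence "x ^ (CARD('a) - 1) * \<Prod>(UNIV-{0}) = \<Prod>(UNIV-{0})"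
    by (simp add: prod.distrib card_Diff_singleton)
  thus ?thesis
    by simp
qed

lemma card_power_eq_1_le:
  assumes "0 < j"
  shows "card {x::'a::{idom}. x ^ j = 1} \<le> j"
proof -
  have "coeff (monom (1::'a) j - 1) j = 1"
    using assms by simp
  hence "monom (1::'a) j - 1 \<noteq> 0"
    by (metis coeff_0 zero_neq_one)
  from card_poly_roots_bound[OF this]
  have "card {x::'a. x ^ j = 1} \<le> degree (monom (1::'a) j - 1)"
    by (simp add: poly_monom)
  also have "\<dots> \<le> j"
    using degree_diff_le[of "monom (1::'a) j" j 1] by (simp add: degree_monom_le)
  finally show ?thesis .
qed

text \<open>Every nonzero element is a root of x^(q-1) - 1 = (x^t - 1) h(x). Here h is nonzero with
  constant term 1 and has degree at most t (s - 1), so at least t of the t s nonzero elements must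
  be roots of the first factor.\<close>

lemma card_roots_of_unity_dvd:
  assumes "CARD('a::{field,finite}) - 1 = t * s" "0 < t"
  shows "card {x::'a. x ^ t = 1} = t"
proof (rule antisym)
  have q1: "CARD('a) > 1"
    by (rule one_less_CARD) 
  hence s: "0 < s"
    using assms by (cases s) auto
  define h :: "'a poly" where "h = (\<Sum>i<s. monom 1 (t * i))"
  have poly_h: "(x ^ t - 1) * poly h x = x ^ (t * s) - 1" for x
    unfolding h_def by (simp add: poly_sum poly_monom power_mult power_diff_1_eq)
  have "poly h 0 = (\<Sum>i<s. if i = 0 then 1 else 0)"
    unfolding h_def poly_sum using assms(2) by (intro sum.cong) (auto simp: poly_monom)
  hence "h \<noteq> 0"
    using s by auto
  hence "card {x. poly h x = 0} \<le> degree h"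
    by (rule card_poly_roots_bound)
  also have "degree h \<le> t * (s - 1)"
    unfolding h_def
  proof (rule degree_sum_le)
    fix i assume "i \<in> {..<s}"
    hence "t * i \<le> t * (s - 1)"
      by (intro mult_left_mono) auto
    thus "degree (monom (1::'a) (t * i)) \<le> t * (s - 1)"
      by (rule order_trans[OF degree_monom_le])
  qed simp
  finally have h: "card {x. poly h x = 0} \<le> t * (s - 1)" .
  have "UNIV - {0::'a} \<subseteq> {x. x ^ t = 1} \<union> {x. poly h x = 0}"
  proof
    fix x :: 'a assume "x \<in> UNIV - {0}"
    hence "x ^ (t * s) = 1"
      using power_CARD_minus_1[of x] assms(1) by simp
    hence "(x ^ t - 1) * poly h x = 0"
      by (simp add: poly_h)
    thus "x \<in> {x. x ^ t = 1} \<union> {x. poly h x = 0}"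
      by simp
  qed
  from card_mono[OF _ this] have "t * s \<le> card {x::'a. x ^ t = 1} + card {x. poly h x = 0}"
    using assms(1) card_Un_le[of "{x::'a. x ^ t = 1}" "{x. poly h x = 0}"]
    by (simp add: card_Diff_singleton)
  moreover have "t * s = t * (s - 1) + t"
    using s by (cases s) auto
  ultimately show "t \<le> card {x::'a. x ^ t = 1}"
    using h by linarith
qed (rule card_power_eq_1_le[OF assms(2)])

text \<open>If t does not divide j, then x^(j mod t) - 1 has too few roots to vanish on all t-th
  roots of unity, so some such z has z^j \<noteq> 1. Multiplication by z permutes the roots of unity
  and multiplies the sum by z^j, which forces the sum to be 0.\<close>

lemma sum_power_roots_of_unity:
  assumes "CARD('a::{field,finite}) - 1 = t * s" "0 < t"
  shows "(\<Sum>x | x ^ t = 1. x ^ j) = (if t dvd j then of_nat t else (0::'a))"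
proof (cases "t dvd j")
  case True
  then show ?thesis
    using card_roots_of_unity_dvd[OF assms] by (auto simp: power_mult)
next
  case False
  have "j mod t < t" "0 < j mod t"
    using False assms(2) by (auto simp: mod_greater_zero_iff_not_dvd)
  have "\<not> {x::'a. x ^ t = 1} \<subseteq> {x. x ^ (j mod t) = 1}"
    using card_mono[of "{x::'a. x ^ (j mod t) = 1}" "{x. x ^ t = 1}"]
      card_power_eq_1_le[OF \<open>0 < j mod t\<close>, where ?'a='a] card_roots_of_unity_dvd[OF assms]
      \<open>j mod t < t\<close> by auto
  then obtain z :: 'a where z: "z ^ t = 1" "z ^ (j mod t) \<noteq> 1"
    by auto
  have "z ^ j = z ^ (t * (j div t) + j mod t)"
    by simp
  also have "\<dots> = z ^ (j mod t)"
    by (simp only: power_add power_mult z power_one mult_1)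
  finally have zj: "z ^ j \<noteq> 1"
    using z by simp
  have "z \<noteq> 0"
    using z assms(2) by (auto simp: power_0_left)
  have "(\<Sum>x | x ^ t = 1. x ^ j) = (\<Sum>x | x ^ t = 1. (z * x) ^ j)"
    by (rule sum.reindex_bij_witness[of _ "\<lambda>x. z * x" "\<lambda>x. x / z"])
      (use z \<open>z \<noteq> 0\<close> in \<open>auto simp: power_mult_distrib power_divide\<close>)
  also have "\<dots> = z ^ j * (\<Sum>x | x ^ t = 1. x ^ j)"
    by (simp add: power_mult_distrib sum_distrib_left)
  finally have "(1 - z ^ j) * (\<Sum>x | x ^ t = 1. x ^ j) = 0"
    by (simp add: algebra_simps)
  then show ?thesis
    using zj False by simp
qed

text \<open>For j > 0 this is the previous lemma with t = q - 1, since q - 1 = -1 in the field. The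
  exponent 0 is separate: with 0^0 = 1 its sum is q = 0.\<close>

lemma sum_power_UNIV:
  "(\<Sum>x\<in>UNIV. x ^ j) = (if 0 < j \<and> (CARD('a) - 1) dvd j then - 1 else (0::'a::{field,finite}))"
proof (cases "j = 0")
  case True
  then show ?thesis
    using of_nat_CARD_eq_0[where ?'a='a] by simp
next
  case False
  have q1: "CARD('a) > 1"
    by (rule one_less_CARD)
  have "of_nat (CARD('a) - 1) = (-1::'a)"
    using q1 of_nat_CARD_eq_0[where ?'a='a] by (simp add: of_nat_diff)
  moreover have "{x::'a. x ^ (CARD('a) - 1) = 1} = UNIV - {0}"
    using power_CARD_minus_1[where ?'a='a] q1 by (auto simp: power_0_left)
  moreover have "(\<Sum>x\<in>UNIV. x ^ j) = (\<Sum>x\<in>UNIV - {0::'a}. x ^ j)"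
    using False by (intro sum.mono_neutral_right) auto
  ultimately show ?thesis
    using sum_power_roots_of_unity[where ?'a='a, of "CARD('a) - 1" 1 j] q1 False by simp
qed

section \<open>Minimum weight and dimension counting\<close>

lemma min_dist_subspace_eqI:
  fixes C :: "('a::{field,finite} ^ 'n) set"
  assumes C: "vec.subspace C"
    and lower: "\<And>x. x \<in> C \<Longrightarrow> x \<noteq> 0 \<Longrightarrow> d \<le> card {i. x $ i \<noteq> 0}"
    and w: "w \<in> C" "w \<noteq> 0" "card {i. w $ i \<noteq> 0} \<le> d"
  shows "min_dist C = d"
  unfolding min_dist_def
proof (rule cInf_eq_minimum)
  have "hamming_dist w 0 = d"
    using lower[of w] w by (simp add: hamming_dist_def)
  thus "d \<in> {hamming_dist x y |x y. x \<in> C \<and> y \<in> C \<and> x \<noteq> y}"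
    using w vec.subspace_0[OF C] by blast
next
  fix m assume "m \<in> {hamming_dist x y |x y. x \<in> C \<and> y \<in> C \<and> x \<noteq> y}"
  then obtain x y where "m = hamming_dist x y" "x \<in> C" "y \<in> C" "x \<noteq> y"
    by blast
  moreover have "hamming_dist x y = card {i. (x - y) $ i \<noteq> 0}"
    by (simp add: hamming_dist_def)
  ultimately show "d \<le> m"
    using lower[of "x - y"] vec.subspace_diff[OF C, of x y] by simp
qed

lemma subspace_euclidean_dual: "vec.subspace (euclidean_dual C)"
  by (auto simp: vec.subspace_def euclidean_dual_def algebra_simps sum.distrib simp flip: sum_distrib_left)

text \<open>Each new equation lowers the dimension by at most one: if v solves the old equations but
  not the new one, then every old solution is a multiple of v plus a solution of all
  equations.\<close>

lemma dim_linear_equations_ge: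
  fixes B :: "('a::field ^ 'n) set"
  assumes "finite B"
  shows "CARD('n) \<le> vec.dim {x. \<forall>b\<in>B. (\<Sum>i\<in>UNIV. b $ i * x $ i) = 0} + card B"
  using assms
proof (induction B)
  case empty
  then show ?case
    using vec_dim_card[where ?'a='a and ?'n='n] by (simp del: vec.dim_UNIV)
next
  case (insert b B)
  define \<phi> :: "'a ^ 'n \<Rightarrow> 'a ^ 'n \<Rightarrow> 'a" where "\<phi> b x = (\<Sum>i\<in>UNIV. b $ i * x $ i)" for b x
  have lin: "\<phi> c (x - r *s v) = \<phi> c x - r * \<phi> c v" for c x r v
    by (simp add: \<phi>_def right_diff_distrib sum_subtractf sum_distrib_left mult.left_commute)
  let ?V = "{x. \<forall>b\<in>B. \<phi> b x = 0}"
  let ?W = "{x. \<forall>b\<in>insert b B. \<phi> b x = 0}"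
  have "vec.dim ?V \<le> vec.dim ?W + 1"
  proof (cases "\<exists>v\<in>?V. \<phi> b v \<noteq> 0")
    case True
    then obtain v where v: "v \<in> ?V" "\<phi> b v \<noteq> 0"
      by blast
    have "?V \<subseteq> vec.span (insert v ?W)"
    proof
      fix x assume "x \<in> ?V"
      hence "x - (\<phi> b x / \<phi> b v) *s v \<in> ?W"
        using v by (simp add: lin)
      from vec.span_base[OF this] show "x \<in> vec.span (insert v ?W)"
        unfolding vec.span_breakdown_eq by (rule exI)
    qed
    hence "vec.dim ?V \<le> vec.dim (insert v ?W)"
      by (rule vec.dim_mono)
    thus ?thesis
      unfolding vec.dim_insert[of v ?W] by presburger
  next
    case False
    hence "?V = ?W"
      by blast
    then show ?thesis
      by simp
  qed
  then show ?case
    using insert unfolding \<phi>_def by simp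
qed

section \<open>The code, its zeros and its dimension\<close>

text \<open>
  The coordinates are indexed by \<open>F\<^sub>q\<close> and two extra points: \<open>Some None\<close> is infinity and \<open>None\<close> is the
  tangent coordinate.
\<close>

locale tangent_code =
  fixes h :: "'n::finite \<Rightarrow> 'a::{field,finite} option option" and k :: nat
  assumes bij_h: "bij h" and three_le_k: "3 \<le> k" and k_le_CARD: "k \<le> CARD('a)"
begin

text \<open>The columns of the generator matrix are points of the normal rational curve (1, a, ...,
  a^(k-1)) with its point at infinity e_{k-1}, together with e_{k-2}. The latter lies on the tangent
  line at infinity, hence the name of that coordinate.\<close>

definition col :: "'a poly \<Rightarrow> 'a option option \<Rightarrow> 'a" where
  "col f y = (case y of None \<Rightarrow> coeff f (k - 2) | Some None \<Rightarrow> coeff f (k - 1)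
                | Some (Some a) \<Rightarrow> poly f a)"

lemma col_simps [simp]:
  "col f None = coeff f (k - 2)"
  "col f (Some None) = coeff f (k - 1)"
  "col f (Some (Some a)) = poly f a"
  by (simp_all add: col_def)

definition enc :: "'a poly \<Rightarrow> 'a ^ 'n" where
  "enc f = (\<chi> i. col f (h i))"

text \<open>General exponent sets are allowed because the hull turns out to be the code of all
  exponents below \<open>k\<close> but one.\<close>

definition code :: "nat set \<Rightarrow> ('a ^ 'n) set" where
  "code I = enc ` {f. \<forall>i. i \<notin> I \<longrightarrow> coeff f i = 0}"

lemma enc_nth [simp]: "enc f $ i = col f (h i)"
  by (simp add: enc_def)

lemma CARD_coords: "CARD('n) = CARD('a) + 2"
  using bij_betw_same_card[OF bij_h] by simp

lemma sum_coords: "(\<Sum>i\<in>UNIV. F (h i)) = (\<Sum>y\<in>UNIV. F y)"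
  by (rule sum.reindex_bij_betw[OF bij_h])

lemma card_coords: "card {i. P (h i)} = card {y. P y}"
proof (rule bij_betw_same_card[of h])
  show "bij_betw h {i. P (h i)} {y. P y}"
    using bij_h by (force simp: bij_betw_def inj_on_def surj_def image_def)
qed

lemma col_add: "col (f + g) y = col f y + col g y"
  and col_smult: "col (smult c f) y = c * col f y"
  and col_0: "col 0 y = 0"
  by (auto simp: col_def split: option.splits)

lemma enc_add: "enc (f + g) = enc f + enc g"
  and enc_smult: "enc (smult c f) = c *s enc f"
  and enc_0: "enc 0 = 0"
  by (simp_all add: vec_eq_iff col_add col_smult col_0)

lemma enc_sum: "enc (sum F A) = (\<Sum>i\<in>A. enc (F i))"
  by (induction A rule: infinite_finite_induct) (simp_all add: enc_0 enc_add)

lemma poly_as_sum_monom: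
  assumes "finite I" "\<And>i. i \<notin> I \<Longrightarrow> coeff f i = 0"
  shows "f = (\<Sum>i\<in>I. smult (coeff f i) (monom (1::'a) i))"
  by (rule poly_eqI) (use assms in \<open>auto simp: coeff_sum if_distrib cong: if_cong\<close>)

text \<open>Degree k - 1 forces a nonzero value at infinity, leaving k - 1 roots and the tangent
  coordinate. Degree k - 2 forces a nonzero tangent coordinate, and degree at most k - 3 leaves room
  for both extra zeros; these cases give at most k - 1 zeros.\<close>

lemma card_zeros_col:
  assumes "f \<noteq> 0" "degree f < k"
  shows "card {y. col f y = 0} \<le> k"
proof -
  have "card {y. col f y = 0} = (if coeff f (k - 2) = 0 then 1 else 0)
          + ((if coeff f (k - 1) = 0 then 1 else 0) + card {a. poly f a = 0})"
    by (simp add: card_Collect_option)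
  moreover have "card {a. poly f a = 0} \<le> degree f"
    using assms by (intro card_poly_roots_bound)
  moreover have "coeff f (degree f) \<noteq> 0"
    using assms by simp
  hence "degree f = k - 1 \<Longrightarrow> coeff f (k - 1) \<noteq> 0" "degree f = k - 2 \<Longrightarrow> coeff f (k - 2) \<noteq> 0"
    by metis+
  moreover have "degree f = k - 1 \<or> degree f = k - 2 \<or> degree f + 3 \<le> k"
    using assms by linarith
  ultimately show ?thesis
    using three_le_k by (auto split: if_splits)
qed

lemma weight_enc: "card {i. enc f $ i \<noteq> 0} + card {y. col f y = 0} = CARD('a) + 2"
proof -
  have "{y. col f y \<noteq> 0} = UNIV - {y. col f y = 0}"
    by auto
  moreover have "card {y. col f y = 0} \<le> CARD('a option option)"
    by (rule card_mono) auto
  ultimately show ?thesis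
    using card_coords[of "\<lambda>y. col f y \<noteq> 0"] by (simp add: card_Diff_subset)
qed

lemma enc_eq_0_iff:
  assumes "degree f < k"
  shows "enc f = 0 \<longleftrightarrow> f = 0"
proof
  assume "enc f = 0"
  hence "card {y. col f y = 0} = CARD('a) + 2"
    using weight_enc[of f] by (simp add: vec_eq_iff)
  thus "f = 0"
    using card_zeros_col[of f] assms k_le_CARD by force
qed (simp add: enc_0)

lemma degree_less_k:
  assumes "I \<subseteq> {..<k}" "\<And>i. i \<notin> I \<Longrightarrow> coeff f i = 0"
  shows "degree f < k"
  using assms three_le_k degree_le[of "k - 1" f] by fastforce

lemma
  assumes "I \<subseteq> {..<k}"
  shows subspace_code: "vec.subspace (code I)" and dim_code: "vec.dim (code I) = card I"
proof -
  have fin: "finite I"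
    using assms finite_subset by blast
  define b where "b i = enc (monom 1 i)" for i
  have enc_b: "enc (\<Sum>i\<in>I. smult (c i) (monom 1 i)) = (\<Sum>i\<in>I. c i *s b i)" for c
    by (simp add: b_def enc_sum enc_smult)
  have indep: "c i = 0" if "(\<Sum>i\<in>I. c i *s b i) = 0" "i \<in> I" for c i
  proof -
    let ?f = "\<Sum>i\<in>I. smult (c i) (monom 1 i)"
    have coeff_f: "coeff ?f j = (if j \<in> I then c j else 0)" for j
      using fin by (simp add: coeff_sum if_distrib cong: if_cong)
    hence "degree ?f < k"
      by (intro degree_less_k[OF assms]) simp
    hence "?f = 0"
      using that(1) enc_eq_0_iff enc_b by metis
    thus ?thesis
      using coeff_f[of i] that(2) by simp
  qed
  \<comment> \<open>A set forgets repetitions, so injectivity is needed to count the basis. Equal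
    images of \<open>i\<close> and \<open>j\<close> would give a relation with coefficients 1 at
    \<open>i\<close> and -1 at \<open>j\<close>.\<close>
  have inj: "inj_on b I"
  proof (rule inj_onI, rule ccontr)
    fix i j assume ij: "i \<in> I" "j \<in> I" "b i = b j" "i \<noteq> j"
    have "(\<Sum>m\<in>I. (if m = i then 1 else if m = j then -1 else 0) *s b m)
            = (\<Sum>m\<in>{i,j}. (if m = i then 1 else if m = j then -1 else 0) *s b m)"
      using ij fin by (intro sum.mono_neutral_right) auto
    also have "\<dots> = 0"
      using ij by simp
    finally show False
      using indep[OF _ \<open>i \<in> I\<close>] by fastforce
  qed
  have "vec.independent (b ` I)"
  proof (rule vec.independent_if_scalars_zero)
    fix c x assume "(\<Sum>x\<in>b ` I. c x *s x) = 0" "x \<in> b ` I"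
    thus "c x = 0"
      using indep[of "c \<circ> b"] inj by (auto simp: sum.reindex)
  qed (use fin in simp)
  have span: "code I = vec.span (b ` I)"
  proof (intro equalityI subsetI)
    fix x assume "x \<in> code I"
    then obtain f where "x = enc f" "\<And>i. i \<notin> I \<Longrightarrow> coeff f i = 0"
      by (auto simp: code_def)
    hence "x = (\<Sum>i\<in>I. coeff f i *s b i)"
      using poly_as_sum_monom[OF fin] enc_b by metis
    thus "x \<in> vec.span (b ` I)"
      by (simp add: vec.span_sum vec.span_scale vec.span_base)
  next
    fix x assume "x \<in> vec.span (b ` I)"
    then obtain c where "x = (\<Sum>v\<in>b ` I. c v *s v)"
      using fin vec.span_finite[of "b ` I"] by auto
    hence "x = enc (\<Sum>i\<in>I. smult (c (b i)) (monom 1 i))"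
      using inj by (simp add: enc_b sum.reindex)
    thus "x \<in> code I"
      unfolding code_def using fin by (auto simp: coeff_sum intro!: imageI sum.neutral)
  qed
  show "vec.subspace (code I)"
    unfolding span by (rule vec.subspace_span)
  show "vec.dim (code I) = card I"
    unfolding span using \<open>vec.independent (b ` I)\<close> inj
    by (simp add: vec.dim_eq_card_independent card_image)
qed

text \<open>By linearity it suffices to test the monomial basis. Leaving \<open>z\<close> an
  arbitrary function lets the lemma serve both the Euclidean dual and the Galois dual, where
  \<open>z\<close> is a coordinatewise power.\<close>

lemma code_annihilator_iff:
  "(\<forall>c\<in>code {..<k}. (\<Sum>i\<in>UNIV. c $ i * z i) = 0)
     \<longleftrightarrow> (\<forall>j<k. (\<Sum>i\<in>UNIV. enc (monom 1 j) $ i * z i) = 0)" (is "?L \<longleftrightarrow> ?R")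
proof
  assume ?L
  thus ?R
    by (auto simp: code_def simp del: enc_nth)
next
  assume R: ?R
  show ?L
  proof
    fix c assume "c \<in> code {..<k}"
    then obtain f where "c = enc f" "\<And>i. i \<notin> {..<k} \<Longrightarrow> coeff f i = 0"
      by (auto simp: code_def)
    hence "c = enc (\<Sum>j<k. smult (coeff f j) (monom 1 j))"
      using poly_as_sum_monom[of "{..<k}" f] by simp
    hence c: "c = (\<Sum>j<k. coeff f j *s enc (monom 1 j))"
      by (simp only: enc_sum enc_smult)
    have "(\<Sum>i\<in>UNIV. c $ i * z i)
            = (\<Sum>j<k. coeff f j * (\<Sum>i\<in>UNIV. enc (monom 1 j) $ i * z i))"
      unfolding c sum_component vector_smult_component sum_distrib_left sum_distrib_right
      by (subst sum.swap) (simp add: mult.assoc)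
    thus "(\<Sum>i\<in>UNIV. c $ i * z i) = 0"
      using R by simp
  qed
qed

section \<open>Minimum distances and the dimension of the dual\<close>

text \<open>This expresses that any k - 1 columns are independent: \<open>f\<close> separates the
  column \<open>y\<close> from at most k - 2 others. It starts from the product \<open>g\<close> of
  the linear factors of the affine points in question.\<close>

lemma dual_witness_polynomial:
  assumes "card (S - {y}) + 2 \<le> k"
  shows "\<exists>f. degree f < k \<and> col f y \<noteq> 0 \<and> (\<forall>z\<in>S - {y}. col f z = 0)"
proof -
  define A where "A = {a. Some (Some a) \<in> S - {y}}"
  define g where "g = (\<Prod>a\<in>A. [:- a, 1:])"
  have inj: "inj_on (\<lambda>a. Some (Some a)) A"
    by (simp add: inj_on_def)
  have img: "(\<lambda>a. Some (Some a)) ` A = (S - {y}) - {None, Some None}"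
  proof (intro equalityI subsetI)
    fix z assume z: "z \<in> (S - {y}) - {None, Some None}"
    then obtain a where "z = Some (Some a)"
      by (metis Diff_iff insert_iff option.exhaust)
    thus "z \<in> (\<lambda>a. Some (Some a)) ` A"
      using z by (simp add: A_def)
  qed (auto simp: A_def)
  hence card_A: "card A = card ((S - {y}) - {None, Some None})"
    using card_image[OF inj] by simp
  have finite_part: "\<exists>b\<in>A. z = Some (Some b)"
    if "z \<in> S - {y}" "z \<notin> {None, Some None}" for z
  proof -
    have "z \<in> (\<lambda>a. Some (Some a)) ` A"
      unfolding img using that by simp
    thus ?thesis
      by auto
  qed
  have card_A_le: "card A + 2 \<le> k"
    unfolding card_A using assms card_mono[of "S - {y}" "S - {y} - {None, Some None}"] by simp
  \<comment> \<open>An extra point among the prescribed zeros uses up one of the k - 2 places, so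
    \<open>g\<close> has degree at most k - 3 and vanishes at both extra points.\<close>
  have card_A_less: "card A + 3 \<le> k" if "z \<in> S - {y}" "z \<in> {None, Some None}" for z
  proof -
    have "S - {y} - {None, Some None} \<subset> S - {y}"
      using that by auto
    from psubset_card_mono[OF _ this] show ?thesis
      unfolding card_A using assms by simp
  qed
  have roots: "poly g a = 0 \<longleftrightarrow> a \<in> A" for a
    by (auto simp: g_def poly_prod)
  have deg_g: "degree g = card A"
    unfolding g_def by (simp add: degree_prod_sum_eq)
  have lead_g: "coeff g (card A) = 1"
    using deg_g lead_coeff_prod[of "\<lambda>a. [:- a, 1:]" A] by (simp add: g_def)
  \<comment> \<open>Padding with a power of x makes the polynomial monic of degree exactly k - 2:
    its tangent coordinate is 1 and its value at infinity is 0.\<close>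
  define m where "m = g * monom 1 (k - 2 - card A)"
  have coeff_m: "coeff m (k - 2) = 1"
  proof -
    have "k - 2 - (k - 2 - card A) = card A"
      using card_A_le by simp
    thus ?thesis
      using lead_g by (simp only: m_def mult.commute[of g] coeff_monom_mult) simp
  qed
  have deg_m: "degree m \<le> k - 2"
    unfolding m_def using card_A_le degree_mult_le[of g "monom 1 (k - 2 - card A)"]
      degree_monom_le[of "1::'a" "k - 2 - card A"] deg_g by linarith
  have roots_m: "poly m a = 0" if "a \<in> A" for a
    using that roots by (simp add: m_def)
  consider a where "y = Some (Some a)" | "y = None" | "y = Some None"
    by (metis option.exhaust)
  thus ?thesis
  proof cases
    case 1
    have "col g z = 0" if "z \<in> S - {y}" for z
    proof (cases "z \<in> {None, Some None}")
      case True
      thus ?thesis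
        using card_A_less[OF that] deg_g by (auto intro!: coeff_eq_0)
    next
      case False
      from finite_part[OF that False] obtain b where "z = Some (Some b)" "b \<in> A"
        by (elim bexE)
      thus ?thesis
        using roots by simp
    qed
    moreover have "col g y \<noteq> 0"
      using 1 roots by (simp add: A_def)
    ultimately show ?thesis
      using card_A_le deg_g by (intro exI[of _ g]) auto
  next
    case 2
    have "col m z = 0" if "z \<in> S - {y}" for z
    proof (cases "z \<in> {None, Some None}")
      case True
      thus ?thesis
        using that 2 deg_m three_le_k by (auto intro!: coeff_eq_0)
    next
      case False
      from finite_part[OF that False] obtain b where "z = Some (Some b)" "b \<in> A"
        by (elim bexE)
      thus ?thesis
        using roots_m by simp
    qed
    thus ?thesis
      using 2 coeff_m deg_m three_le_k by (intro exI[of _ m]) auto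
  next
    case 3
    \<comment> \<open>This is (x - c) m with c the coefficient of x^(k-3) in \<open>m\<close>,
      chosen so that the coefficient of x^(k-2) cancels while the leading coefficient at x^(k-1)
      stays 1.\<close>
    define f where "f = pCons 0 m - smult (coeff m (k - 3)) m"
    have km: "k - 2 = Suc (k - 3)" "k - 1 = Suc (k - 2)"
      using three_le_k by auto
    have "coeff m (k - 1) = 0"
      using deg_m three_le_k by (intro coeff_eq_0) auto
    hence f1: "coeff f (k - 1) = 1"
      using coeff_m unfolding f_def km(2) by simp
    have f2: "coeff f (k - 2) = 0"
      using coeff_m unfolding f_def km(1) by simp
    have "degree f \<le> k - 1"
      unfolding f_def using deg_m km
      by (intro degree_diff_le order_trans[OF degree_pCons_le] order_trans[OF degree_smult_le]) auto
    moreover have "col f z = 0" if "z \<in> S - {y}" for z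
    proof (cases "z \<in> {None, Some None}")
      case True
      thus ?thesis
        using that 3 f2 by auto
    next
      case False
      from finite_part[OF that False] obtain b where "z = Some (Some b)" "b \<in> A"
        by (elim bexE)
      thus ?thesis
        using roots_m by (simp add: f_def)
    qed
    ultimately show ?thesis
      using 3 f1 three_le_k by (intro exI[of _ f]) auto
  qed
qed

abbreviation C :: "('a ^ 'n) set" where
  "C \<equiv> code {..<k}"

lemma enc_in_C: "degree f < k \<Longrightarrow> enc f \<in> C"
  by (auto simp: code_def intro!: imageI coeff_eq_0)

lemma C_E:
  assumes "x \<in> C"
  obtains f where "degree f < k" "x = enc f" "\<And>i. i \<ge> k \<Longrightarrow> coeff f i = 0"
proof -
  from assms obtain f where f: "x = enc f" "\<And>i. i \<notin> {..<k} \<Longrightarrow> coeff f i = 0"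
    by (auto simp: code_def)
  with degree_less_k[of "{..<k}" f] that[of f] show thesis
    by simp
qed

lemma min_dist_code:
  assumes "f \<noteq> 0" "degree f < k" "k \<le> card {y. col f y = 0}"
  shows "min_dist C = CARD('a) + 2 - k"
proof (rule min_dist_subspace_eqI)
  show "vec.subspace C"
    by (rule subspace_code) simp
  fix x assume x: "x \<in> C" "x \<noteq> 0"
  then obtain g where g: "degree g < k" "x = enc g"
    by (auto elim: C_E)
  with x have "g \<noteq> 0"
    using enc_0 by auto
  thus "CARD('a) + 2 - k \<le> card {i. x $ i \<noteq> 0}"
    using g card_zeros_col[of g] weight_enc[of g] by simp
next
  show "enc f \<in> C"
    using assms by (intro enc_in_C)
  show "enc f \<noteq> 0"
    using assms enc_eq_0_iff by simp
  show "card {i. enc f $ i \<noteq> 0} \<le> CARD('a) + 2 - k"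
    using assms weight_enc[of f] by simp
qed

text \<open>A nonzero dual word of weight below \<open>k\<close> would be a relation among at most k
  - 1 columns. The witness polynomial isolates a single nonzero summand of it.\<close>

lemma dual_weight_ge:
  assumes x: "x \<in> euclidean_dual C" "x \<noteq> 0"
  shows "k \<le> card {i. x $ i \<noteq> 0}"
proof (rule ccontr)
  assume "\<not> k \<le> card {i. x $ i \<noteq> 0}"
  hence small: "card {i. x $ i \<noteq> 0} < k"
    by simp
  obtain i0 where i0: "x $ i0 \<noteq> 0"
    using x(2) by (auto simp: vec_eq_iff)
  define S where "S = h ` {i. x $ i \<noteq> 0}"
  have "card S \<le> card {i. x $ i \<noteq> 0}"
    unfolding S_def by (rule card_image_le) simp
  moreover have "h i0 \<in> S"
    using i0 by (simp add: S_def)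
  hence "card S = Suc (card (S - {h i0}))"
    by (intro card.remove) simp_all
  ultimately have "card (S - {h i0}) + 2 \<le> k"
    using small by simp
  from dual_witness_polynomial[OF this] obtain f
    where f: "degree f < k" "col f (h i0) \<noteq> 0" "\<forall>z\<in>S - {h i0}. col f z = 0"
    by blast
  have "col f (h i) * x $ i = 0" if "i \<noteq> i0" for i
  proof (cases "x $ i = 0")
    case False
    hence "h i \<in> S - {h i0}"
      using that bij_h by (auto simp: S_def bij_def inj_def)
    thus ?thesis
      using f(3) by simp
  qed simp
  hence "(\<Sum>i\<in>UNIV. enc f $ i * x $ i) = (\<Sum>i\<in>{i0}. enc f $ i * x $ i)"
    by (intro sum.mono_neutral_right) auto
  moreover have "(\<Sum>i\<in>UNIV. enc f $ i * x $ i) = 0"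
    using x(1) enc_in_C[OF f(1)] by (auto simp: euclidean_dual_def)
  ultimately show False
    using f(2) i0 by simp
qed

lemma in_dual_iff:
  "x \<in> euclidean_dual C \<longleftrightarrow> (\<forall>j<k. (\<Sum>i\<in>UNIV. enc (monom 1 j) $ i * x $ i) = 0)"
  unfolding euclidean_dual_def mem_Collect_eq by (rule code_annihilator_iff)

lemma min_dist_dual:
  assumes "w y \<noteq> 0" "card {y. w y \<noteq> 0} \<le> k"
    and "\<And>j. j < k \<Longrightarrow> (\<Sum>y\<in>UNIV. col (monom 1 j) y * w y) = 0"
  shows "min_dist (euclidean_dual C) = k"
proof (rule min_dist_subspace_eqI)
  show "vec.subspace (euclidean_dual C)"
    by (rule subspace_euclidean_dual)
  let ?x = "(\<chi> i. w (h i)) :: 'a ^ 'n"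
  show "?x \<in> euclidean_dual C"
    unfolding in_dual_iff
    using assms(3) sum_coords[of "\<lambda>y. col (monom 1 _) y * w y"] by simp
  obtain i where "h i = y"
    using bij_h by (metis bij_pointE)
  thus "?x \<noteq> 0"
    using assms(1) by (auto simp: vec_eq_iff)
  show "card {i. ?x $ i \<noteq> 0} \<le> k"
    using assms(2) card_coords[of "\<lambda>y. w y \<noteq> 0"] by simp
qed (rule dual_weight_ge)

text \<open>Vandermonde independence of \<open>k\<close> affine columns, seen by pairing with the
  product of the linear factors of all points but one. It bounds the dimension of the dual from
  above.\<close>

lemma dual_supported_on_k_points:
  assumes "card K = k" "x \<in> euclidean_dual C"
    and supp: "\<And>i. h i \<notin> Some ` Some ` K \<Longrightarrow> x $ i = 0"
  shows "x = 0"
proof (rule ccontr)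
  assume "x \<noteq> 0"
  then obtain i0 where i0: "x $ i0 \<noteq> 0"
    by (auto simp: vec_eq_iff)
  then obtain a where a: "a \<in> K" "h i0 = Some (Some a)"
    using supp by blast
  define f where "f = (\<Prod>b\<in>K - {a}. [:- b, 1:])"
  have "degree f = k - 1"
    unfolding f_def using assms(1) a(1) by (simp add: degree_prod_sum_eq)
  hence deg: "degree f < k"
    using three_le_k by simp
  have "col f (h i) * x $ i = 0" if "i \<noteq> i0" for i
  proof (cases "h i \<in> Some ` Some ` K")
    case True
    then obtain b where b: "b \<in> K" "h i = Some (Some b)"
      by blast
    moreover have "h i \<noteq> h i0"
      using that bij_h by (simp add: bij_def inj_eq)
    ultimately show ?thesis
      using a by (auto simp: f_def poly_prod)
  qed (simp add: supp)
  hence "(\<Sum>i\<in>UNIV. enc f $ i * x $ i) = (\<Sum>i\<in>{i0}. enc f $ i * x $ i)"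
    by (intro sum.mono_neutral_right) auto
  moreover have "(\<Sum>i\<in>UNIV. enc f $ i * x $ i) = 0"
    using assms(2) enc_in_C[OF deg] by (auto simp: euclidean_dual_def)
  moreover have "col f (h i0) \<noteq> 0"
    using a by (auto simp: f_def poly_prod)
  ultimately show False
    using i0 by simp
qed

text \<open>From above, the dual meets trivially the k-dimensional space of words supported on
  \<open>k\<close> affine coordinates. From below, it is cut out by at most \<open>k\<close>
  equations.\<close>

lemma dim_dual: "vec.dim (euclidean_dual C) = CARD('a) + 2 - k"
proof (rule antisym)
  obtain K :: "'a set" where K: "card K = k"
    using k_le_CARD obtain_subset_with_card_n by metis
  define D where "D = {i. h i \<in> Some ` Some ` K}"
  have "card D = card {y. y \<in> Some ` Some ` K}"
    unfolding D_def by (rule card_coords)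
  hence D: "card D = k"
    using K by (simp add: card_image)
  define W where "W = {x::'a ^ 'n. \<forall>i. i \<notin> D \<longrightarrow> x $ i = 0}"
  have W: "vec.subspace W" "vec.dim W = k"
    unfolding W_def dim_substandard_cart D by (auto simp: vec.subspace_def)
  have "euclidean_dual C \<inter> W \<subseteq> {0}"
    using dual_supported_on_k_points[OF K] by (auto simp: W_def D_def)
  hence "vec.dim (euclidean_dual C \<inter> W) = 0"
    by (subst vec.dim_eq_0)
  moreover have "vec.dim {x + y |x y. x \<in> euclidean_dual C \<and> y \<in> W} \<le> CARD('a) + 2"
    unfolding CARD_coords[symmetric] by (rule dim_subset_UNIV_cart_gen)
  ultimately show "vec.dim (euclidean_dual C) \<le> CARD('a) + 2 - k"
    using vec.dim_sums_Int[OF subspace_euclidean_dual W(1), of C] W(2) by linarith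
  let ?B = "(\<lambda>j. enc (monom 1 j)) ` {..<k}"
  have "euclidean_dual C = {x. \<forall>b\<in>?B. (\<Sum>i\<in>UNIV. b $ i * x $ i) = 0}"
    by (auto simp: in_dual_iff)
  moreover have "card ?B \<le> k"
    using card_image_le[of "{..<k}" "\<lambda>j. enc (monom 1 j)"] by simp
  ultimately show "CARD('a) + 2 - k \<le> vec.dim (euclidean_dual C)"
    using dim_linear_equations_ge[of ?B] CARD_coords by simp
qed

lemma NMDS_code:
  assumes "f \<noteq> 0" "degree f < k" "k \<le> card {y. col f y = 0}"
    and "w y \<noteq> 0" "card {y. w y \<noteq> 0} \<le> k"
    and "\<And>j. j < k \<Longrightarrow> (\<Sum>y\<in>UNIV. col (monom 1 j) y * w y) = 0"
  shows "linear_code (CARD('a) + 2) k (CARD('a) + 2 - k) CARD('a) C" "NMDS C"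
proof -
  have "vec.subspace C" "vec.dim C = k"
    using subspace_code[of "{..<k}"] dim_code[of "{..<k}"] by simp_all
  moreover note min_dist_code[OF assms(1-3)] min_dist_dual[OF assms(4-6)] dim_dual CARD_coords
    subspace_euclidean_dual[of C] k_le_CARD
  ultimately show "linear_code (CARD('a) + 2) k (CARD('a) + 2 - k) CARD('a) C" "NMDS C"
    by (simp_all add: linear_code_def NMDS_def AMDS_def)
qed

section \<open>The Galois form and the hull\<close>

text \<open>Raising to the power p^l is additive, so the affine coordinates give power sums with
  exponents j + i p^l. The last two summands come from infinity and the tangent coordinate, where
  the monomial x^j is 1 or 0.\<close>

lemma gram_monom:
  assumes "prime p" "CARD('a) = p ^ e" "\<And>i. i \<ge> k \<Longrightarrow> coeff g i = 0"
  shows "(\<Sum>i\<in>UNIV. enc (monom 1 j) $ i * enc g $ i ^ (p ^ l)) =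
    (\<Sum>i<k. if 0 < j + i * p ^ l \<and> (CARD('a) - 1) dvd (j + i * p ^ l) then - (coeff g i ^ p ^ l) else 0)
      + (if j = k - 1 then coeff g (k - 1) ^ p ^ l else 0)
      + (if j = k - 2 then coeff g (k - 2) ^ p ^ l else 0)"
proof -
  have char: "CHAR('a) = p"
    by (rule CHAR_eq_prime_of_CARD[OF assms(1,2)])
  have "poly g a = (\<Sum>i<k. coeff g i * a ^ i)" for a
  proof -
    have "degree g < k"
      using degree_less_k[of "{..<k}" g] assms(3) by simp
    hence "(\<Sum>i\<le>degree g. coeff g i * a ^ i) = (\<Sum>i<k. coeff g i * a ^ i)"
      by (intro sum.mono_neutral_left) (auto intro: coeff_eq_0)
    thus ?thesis
      by (simp add: poly_altdef)
  qed
  hence pow: "poly g a ^ p ^ l = (\<Sum>i<k. coeff g i ^ p ^ l * a ^ (i * p ^ l))" for a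
    using freshmans_dream_sum'[of "p ^ l" l "\<lambda>i. coeff g i * a ^ i" "{..<k}"] char assms(1)
    by (simp add: power_mult_distrib power_mult)
  have "(\<Sum>a\<in>UNIV. a ^ j * poly g a ^ p ^ l)
          = (\<Sum>i<k. coeff g i ^ p ^ l * (\<Sum>a\<in>UNIV. a ^ (j + i * p ^ l)))"
    unfolding pow sum_distrib_left by (subst sum.swap) (simp add: power_add mult_ac)
  also have "\<dots> = (\<Sum>i<k. if 0 < j + i * p ^ l \<and> (CARD('a) - 1) dvd (j + i * p ^ l)
                       then - (coeff g i ^ p ^ l) else 0)"
    unfolding sum_power_UNIV by (intro sum.cong) auto
  finally have *: "(\<Sum>a\<in>UNIV. a ^ j * poly g a ^ p ^ l) = \<dots>" .
  have "(\<Sum>i\<in>UNIV. enc (monom 1 j) $ i * enc g $ i ^ (p ^ l))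
          = (\<Sum>y\<in>UNIV. col (monom 1 j) y * col g y ^ p ^ l)"
    using sum_coords[of "\<lambda>y. col (monom 1 j) y * col g y ^ p ^ l"] by simp
  also have "\<dots> = (\<Sum>a\<in>UNIV. a ^ j * poly g a ^ p ^ l)
      + (if j = k - 1 then coeff g (k - 1) ^ p ^ l else 0)
      + (if j = k - 2 then coeff g (k - 2) ^ p ^ l else 0)"
    by (simp add: sum_UNIV_option poly_monom)
  finally show ?thesis
    unfolding * .
qed

text \<open>The second assumption makes orthogonality to the whole code a single linear condition,
  so the hull is spanned by the monomials other than x^m.\<close>

lemma dim_galois_hull:
  assumes "m < k"
    and "\<And>g. (\<And>i. i \<ge> k \<Longrightarrow> coeff g i = 0) \<Longrightarrow>
      (\<forall>j<k. (\<Sum>i\<in>UNIV. enc (monom 1 j) $ i * enc g $ i ^ (p ^ l)) = 0) \<longleftrightarrow> coeff g m = 0"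
  shows "vec.dim (galois_hull p l C) = k - 1"
proof -
  have dual: "x \<in> galois_dual p l C
      \<longleftrightarrow> (\<forall>j<k. (\<Sum>i\<in>UNIV. enc (monom 1 j) $ i * x $ i ^ (p ^ l)) = 0)" for x
    unfolding galois_dual_def galois_inner_def mem_Collect_eq by (rule code_annihilator_iff)
  have "galois_hull p l C = code ({..<k} - {m})"
  proof (intro equalityI subsetI)
    fix x assume x: "x \<in> galois_hull p l C"
    then obtain g where g: "x = enc g" "\<And>i. i \<ge> k \<Longrightarrow> coeff g i = 0"
      by (auto simp: galois_hull_def elim: C_E)
    with x assms(2)[of g] have "coeff g m = 0"
      unfolding galois_hull_def using dual by blast
    thus "x \<in> code ({..<k} - {m})"
      unfolding code_def using g by (auto intro!: imageI)
  next
    fix x assume "x \<in> code ({..<k} - {m})"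
    then obtain g where g: "x = enc g" "\<And>i. i \<notin> {..<k} - {m} \<Longrightarrow> coeff g i = 0"
      by (auto simp: code_def)
    hence "coeff g m = 0" "\<And>i. i \<ge> k \<Longrightarrow> coeff g i = 0"
      by auto
    with assms(2)[of g] g(1) dual[of x] have "x \<in> galois_dual p l C"
      by blast
    moreover have "x \<in> C"
      unfolding code_def using g by auto
    ultimately show "x \<in> galois_hull p l C"
      by (simp add: galois_hull_def)
  qed
  thus ?thesis
    using dim_code[of "{..<k} - {m}"] assms(1) by simp
qed

end

section \<open>Arithmetic of the exponents\<close>

lemma square_minus_one_dvd:
  fixes Q :: nat
  assumes "0 < Q"
  shows "Q\<^sup>2 - 1 dvd (Q ^ 2) ^ m - 1"
proof -
  have "int (Q\<^sup>2) - 1 dvd int (Q\<^sup>2) ^ m - 1"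
    by (simp add: power_diff_1_eq)
  moreover have "int ((Q ^ 2) ^ m - 1) = int (Q\<^sup>2) ^ m - 1" "int (Q\<^sup>2 - 1) = int (Q\<^sup>2) - 1"
    using assms by (simp_all add: of_nat_diff)
  ultimately show ?thesis
    by (metis int_dvd_int_iff)
qed

text \<open>The exponent is at most t + t Q = t (Q + 1), with equality only when both indices are
  maximal.\<close>

lemma exponent_eq_iff_0:
  fixes Q t i j :: nat
  assumes "i \<le> t" "j \<le> t" "0 < t" "0 < Q"
  shows "0 < j + i * Q \<and> t * (Q + 1) dvd j + i * Q \<longleftrightarrow> i = t \<and> j = t"
proof
  assume *: "0 < j + i * Q \<and> t * (Q + 1) dvd j + i * Q"
  hence "t * (Q + 1) \<le> j + i * Q"
    using dvd_imp_le[of "t * (Q + 1)" "j + i * Q"] by simp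
  hence "t * Q + t \<le> j + i * Q"
    by simp
  moreover have "i * Q \<le> t * Q"
    using assms by simp
  ultimately have "j = t" "t * Q \<le> i * Q"
    using assms(2) by linarith+
  thus "i = t \<and> j = t"
    using assms by simp
qed (use assms in auto)

text \<open>The exponent is at most (t + 1)(Q + 1) < 2 t (Q + 1), so it must equal t (Q + 1), that
  is, j + i Q = t + t Q. An index i < t would need j >= t + Q > t + 1. The bound Q <= t keeps t - Q
  from truncating.\<close>

lemma exponent_eq_iff_1:
  fixes Q t i j :: nat
  assumes "i \<le> t + 1" "j \<le> t + 1" "Q \<le> t" "2 \<le> Q"
  shows "0 < j + i * Q \<and> t * (Q + 1) dvd j + i * Q \<longleftrightarrow> i = t \<and> j = t \<or> i = t + 1 \<and> j = t - Q"
proof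
  assume *: "0 < j + i * Q \<and> t * (Q + 1) dvd j + i * Q"
  then obtain c where c: "j + i * Q = t * (Q + 1) * c"
    by (auto elim: dvdE)
  have "i * Q \<le> (t + 1) * Q"
    using assms by (intro mult_right_mono) auto
  hence "j + i * Q \<le> t * (Q + 1) + (Q + 1)"
    using assms by (simp add: algebra_simps)
  also have "\<dots> < t * (Q + 1) * 2"
  proof -
    have "2 * (Q + 1) \<le> t * (Q + 1)"
      using assms by (intro mult_right_mono) auto
    thus ?thesis
      by (simp add: algebra_simps)
  qed
  finally have "c < 2"
    unfolding c mult_less_cancel1 by blast
  hence "c = 1"
    using c * by (cases "c = 0") auto
  hence eq: "j + i * Q = t * (Q + 1)"
    using c by simp
  consider "i = t + 1" | "i = t" | "i + 1 \<le> t"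
    using assms by linarith
  thus "i = t \<and> j = t \<or> i = t + 1 \<and> j = t - Q"
  proof cases
    case 3
    hence "(i + 1) * Q \<le> t * Q"
      by (intro mult_right_mono) auto
    thus ?thesis
      using eq assms by (simp add: algebra_simps)
  qed (use eq assms in \<open>auto simp: algebra_simps\<close>)
qed (use assms in \<open>auto simp: algebra_simps\<close>)

section \<open>Existence of the code for the given parameters\<close>

theorem mainTheorem16:
  fixes p e l q k \<xi> :: nat
  assumes "prime p"
    and "q = p ^ e"
    and "q > 4"
    and "CARD('a::{field,finite}) = q"
    and "CARD('n::finite) = q + 2"
    and "l > 0"
    and "2 * l dvd e"
    and "\<xi> \<le> min 1 ((q - 1) div (p ^ l * (p ^ l + 1)))"
    and "k = \<xi> + 1 + (q - 1) div (p ^ l + 1)"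
  shows "\<exists>C :: ('a ^ 'n) set.
           linear_code (q + 2) k (q + 2 - k) q C \<and>
           AMDS C \<and>
           vec.dim (galois_hull p l C) = k - 1 \<and>
           NMDS C"
proof -
  define Q where "Q = p ^ l"
  define t where "t = (q - 1) div (Q + 1)"
  have k: "k = \<xi> + 1 + t"
    using assms(9) by (simp add: t_def Q_def)
  have Q2: "2 \<le> Q"
    using prime_ge_2_nat[OF assms(1)] assms(6) self_le_power[of p l] unfolding Q_def by linarith
  obtain m where "e = 2 * l * m"
    using assms(7) by (auto elim: dvdE)
  hence qQ: "q = (Q\<^sup>2) ^ m"
    using assms(2) by (simp add: Q_def flip: power_mult) (simp add: mult_ac)
  \<comment> \<open>Here 2 l | e enters: Q + 1 divides Q^2 - 1, which divides (Q^2)^m - 1 = q -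
    1.\<close>
  have "Q + 1 dvd Q\<^sup>2 - 1"
    by (rule dvdI[of _ _ "Q - 1"]) (use Q2 in \<open>simp add: power2_eq_square algebra_simps\<close>)
  hence "Q + 1 dvd q - 1"
    unfolding qQ using square_minus_one_dvd[of Q m] Q2 dvd_trans by force
  hence tQ: "t * (Q + 1) = q - 1"
    unfolding t_def by (rule dvd_div_mult_self)
  have "m \<noteq> 0"
    by (rule notI) (use qQ assms(3) in simp)
  hence q_ge: "Q\<^sup>2 \<le> q"
    unfolding qQ using Q2 \<open>m \<noteq> 0\<close> by (intro self_le_power) auto
  \<comment> \<open>Otherwise q <= Q + 2, and with 2 Q <= Q^2 <= q this gives Q <= 2 and q <=
    4.\<close>
  have t2: "2 \<le> t"
  proof (rule ccontr)
    assume "\<not> 2 \<le> t"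
    hence "t * (Q + 1) \<le> 1 * (Q + 1)"
      by (intro mult_right_mono) auto
    hence "q \<le> Q + 2"
      unfolding tQ by simp
    moreover have "2 * Q \<le> Q\<^sup>2"
      using Q2 by (simp add: power2_eq_square)
    ultimately show False
      using q_ge assms(3) by linarith
  qed
  have \<xi>: "\<xi> = 0 \<or> \<xi> = 1 \<and> Q \<le> t"
  proof (cases "\<xi> = 0")
    case False
    hence "\<xi> = 1" "1 \<le> (q - 1) div (Q * (Q + 1))"
      using assms(8) by (auto simp: Q_def)
    hence "Q * (Q + 1) \<le> t * (Q + 1)"
      unfolding tQ by (metis div_greater_zero_iff less_le_trans zero_less_one)
    hence "Q \<le> t"
      unfolding mult_le_cancel2 by simp
    thus ?thesis
      using \<open>\<xi> = 1\<close> by simp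
  qed simp
  have "t * 3 \<le> q - 1"
    unfolding tQ[symmetric] using Q2 by (intro mult_left_mono) auto
  hence kq: "k \<le> q"
    using \<xi> t2 k by auto
  have "CARD('n) = CARD('a option option)"
    using assms(4,5) by simp
  then obtain h :: "'n \<Rightarrow> 'a option option" where "bij h"
    using finite_same_card_bij[of "UNIV::'n set" "UNIV::'a option option set"] by auto
  then interpret tangent_code h k
    using k t2 kq assms(4) by unfold_locales auto

  \<comment> \<open>In the field, t (Q + 1) = q - 1 = -1, so t is invertible. This makes the tangent
    entry -t of the dual words below nonzero.\<close>
  have "of_nat t * of_nat (Q + 1) = (of_nat (q - 1) :: 'a)"
    using tQ of_nat_mult by metis
  also have "\<dots> = -1"
    using of_nat_CARD_eq_0[where ?'a='a] assms(3,4) by (simp add: of_nat_diff)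
  finally have t_nz: "(of_nat t :: 'a) \<noteq> 0"
    by auto
  define \<mu> where "\<mu> = {x::'a. x ^ t = 1}"
  have card_\<mu>: "card \<mu> = t"
    unfolding \<mu>_def using tQ t2 assms(4) by (intro card_roots_of_unity_dvd[of _ "Q + 1"]) auto
  have sum_\<mu>: "(\<Sum>x\<in>\<mu>. x ^ j) = (if t dvd j then of_nat t else 0)" for j
    unfolding \<mu>_def using tQ t2 assms(4) by (intro sum_power_roots_of_unity[of _ "Q + 1"]) auto
  have "0 \<notin> \<mu>"
    using t2 by (simp add: \<mu>_def power_0_left)
  have CARD_tQ: "CARD('a) - 1 = t * (p ^ l + 1)"
    using tQ assms(4) by (simp add: Q_def)
  \<comment> \<open>The word \<open>f\<close> of minimum weight vanishes on the roots of \<open>x\<^sup>\<xi> (x\<^sup>t - 1)\<close> and at the tangent coordinate;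
    the dual word \<open>w\<close> expresses the coefficient \<open>f\<^bsub>k-2\<^esub>\<close> through the values of \<open>f\<close> at these roots.\<close>
  have "(\<exists>f. f \<noteq> 0 \<and> degree f < k \<and> k \<le> card {y. col f y = 0}) \<and>
        (\<exists>w. w None \<noteq> 0 \<and> card {y. w y \<noteq> 0} \<le> k \<and>
           (\<forall>j<k. (\<Sum>y\<in>UNIV. col (monom 1 j) y * w y) = 0)) \<and>
        vec.dim (galois_hull p l C) = k - 1"
  proof (cases "\<xi> = 0")
    case True
    hence kt: "k = t + 1" "k - 1 = t" "k - 2 = t - 1"
      using k by auto
    define f where "f = monom (1::'a) t - 1"
    have f_t: "coeff f t = 1" and f_t': "coeff f (t - 1) = 0"
      using t2 by (simp_all add: f_def)
    have "{a. poly f a = 0} = \<mu>"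
      by (simp add: f_def \<mu>_def poly_monom)
    hence "card {y. col f y = 0} = t + 1"
      using f_t f_t' card_\<mu> by (simp add: card_Collect_option kt(2,3) del: One_nat_def)
    hence "card {y. col f y = 0} = k"
      by (simp only: kt(1))
    moreover have "f \<noteq> 0"
      using f_t by auto
    moreover have "degree f < k"
      unfolding kt f_def by (intro degree_diff_less) (auto intro: le_less_trans[OF degree_monom_le])
    \<comment> \<open>Summing a f(a) over the t-th roots of unity gives t f_{t-1}: for j < k the
      exponent j + 1 lies between 1 and t + 1 < 2 t, so it is divisible by t only when j = t - 1.
      The entry -t at the tangent coordinate cancels this.\<close>
    moreover define w :: "'a option option \<Rightarrow> 'a" where "w y = (case y of None \<Rightarrow> - of_nat t | Some None \<Rightarrow> 0
        | Some (Some a) \<Rightarrow> if a \<in> \<mu> then a else 0)" for y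
    have w: "w None = - of_nat t" "w (Some None) = 0" "w (Some (Some a)) = (if a \<in> \<mu> then a else 0)" for a
      by (simp_all add: w_def)
    have "{a. w (Some (Some a)) \<noteq> 0} = \<mu>"
      using \<open>0 \<notin> \<mu>\<close> by (auto simp: w)
    hence "card {y. w y \<noteq> 0} \<le> k"
      using card_\<mu> by (simp add: card_Collect_option w kt)
    moreover have "(\<Sum>y\<in>UNIV. col (monom 1 j) y * w y) = 0" if "j < k" for j
    proof -
      have "(\<Sum>a\<in>UNIV. a ^ j * (if a \<in> \<mu> then a else 0)) = (\<Sum>a\<in>\<mu>. a ^ Suc j)"
        by (rule sum.mono_neutral_cong_right) auto
      moreover have "t dvd Suc j \<longleftrightarrow> j = t - 1"
      proof
        assume "t dvd Suc j"
        then obtain c where c: "Suc j = t * c"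
          by (auto elim: dvdE)
        have "t * c < t * 2"
          unfolding c[symmetric] using that t2 kt(1) by simp
        hence "c < 2"
          unfolding mult_less_cancel1 by blast
        hence "c = 1"
          using c by (cases "c = 0") auto
        thus "j = t - 1"
          using c by simp
      qed (use t2 in auto)
      ultimately show ?thesis
        unfolding sum_\<mu> by (simp add: sum_UNIV_option w poly_monom kt(2,3) del: One_nat_def)
    qed
    \<comment> \<open>The coordinate at infinity contributes g_t^Q for j = t and cancels the power
      sum. Only g_{t-1}^Q from the tangent coordinate remains, so the omitted exponent is k -
      2.\<close>
    moreover have "vec.dim (galois_hull p l C) = k - 1"
    proof (rule dim_galois_hull)
      show "k - 2 < k"
        using three_le_k by simp
      fix g :: "'a poly" assume g: "\<And>i. i \<ge> k \<Longrightarrow> coeff g i = 0"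
      have "(\<Sum>i\<in>UNIV. enc (monom 1 j) $ i * enc g $ i ^ p ^ l)
              = (if j = t - 1 then coeff g (t - 1) ^ p ^ l else 0)" if "j < k" for j
      proof -
        have "(\<Sum>i<k. if 0 < j + i * p ^ l \<and> (CARD('a) - 1) dvd (j + i * p ^ l)
                 then - (coeff g i ^ p ^ l) else 0)
              = (\<Sum>i<k. if i = t then (if j = t then - (coeff g t ^ p ^ l) else 0) else 0)"
        proof (rule sum.cong)
          fix i assume "i \<in> {..<k}"
          hence "0 < j + i * p ^ l \<and> (CARD('a) - 1) dvd (j + i * p ^ l) \<longleftrightarrow> i = t \<and> j = t"
            unfolding CARD_tQ using that kt(1) t2 prime_gt_0_nat[OF assms(1)]
            by (intro exponent_eq_iff_0) auto
          thus "(if 0 < j + i * p ^ l \<and> (CARD('a) - 1) dvd (j + i * p ^ l)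
                 then - (coeff g i ^ p ^ l) else 0)
              = (if i = t then (if j = t then - (coeff g t ^ p ^ l) else 0) else 0)"
            by auto
        qed simp
        also have "\<dots> = (if j = t then - (coeff g t ^ p ^ l) else 0)"
          using kt(1) by simp
        finally show ?thesis
          using gram_monom[OF assms(1) assms(4)[unfolded assms(2)] g, where j = j and l = l] t2
          unfolding kt(2,3) by simp
      qed
      moreover have "t - 1 < k"
        using kt(1) by simp
      ultimately show "(\<forall>j<k. (\<Sum>i\<in>UNIV. enc (monom 1 j) $ i * enc g $ i ^ p ^ l) = 0)
              \<longleftrightarrow> coeff g (k - 2) = 0"
        using \<open>t - 1 < k\<close> prime_gt_0_nat[OF assms(1)] unfolding kt(2,3)
        by (auto simp del: One_nat_def)
    qed
    ultimately show ?thesis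
      using t_nz w(1) by (intro conjI exI[of _ f] exI[of _ w]) auto
  next
    case False
    hence kt: "k = t + 2" "k - 1 = t + 1" "k - 2 = t" and Qt: "Q \<le> t"
      using k \<xi> by auto
    define f where "f = monom (1::'a) (t + 1) - monom 1 1"
    have f_t: "coeff f (t + 1) = 1" and f_t': "coeff f t = 0"
      using t2 by (simp_all add: f_def)
    have "poly f a = a * (a ^ t - 1)" for a
      by (simp add: f_def poly_monom algebra_simps)
    hence "{a. poly f a = 0} = insert 0 \<mu>"
      by (auto simp: \<mu>_def)
    hence "card {y. col f y = 0} = t + 2"
      using f_t f_t' card_\<mu> \<open>0 \<notin> \<mu>\<close> by (simp add: card_Collect_option kt(2,3) del: One_nat_def)
    hence "card {y. col f y = 0} = k"
      by (simp only: kt(1))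
    moreover have "f \<noteq> 0"
      using f_t by auto
    moreover have "degree f < k"
      unfolding kt f_def by (intro degree_diff_less) (auto intro: le_less_trans[OF degree_monom_le])
    \<comment> \<open>Summing f(a) over the roots of unity gives t (f_0 + f_t), because 0 and t are
      the only multiples of t up to t + 1 < 2 t. The entries -t at the point 0 and at the tangent
      coordinate remove the two terms.\<close>
    moreover define w :: "'a option option \<Rightarrow> 'a" where "w y = (case y of None \<Rightarrow> - of_nat t | Some None \<Rightarrow> 0
        | Some (Some a) \<Rightarrow> (if a \<in> \<mu> then 1 else 0) + (if a = 0 then - of_nat t else 0))" for y
    have w: "w None = - of_nat t" "w (Some None) = 0"
      "w (Some (Some a)) = (if a \<in> \<mu> then 1 else 0) + (if a = 0 then - of_nat t else 0)" for a
      by (simp_all add: w_def)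
    have "{a. w (Some (Some a)) \<noteq> 0} \<subseteq> insert 0 \<mu>"
      by (auto simp: w)
    hence "card {a. w (Some (Some a)) \<noteq> 0} \<le> t + 1"
      using card_mono[of "insert 0 \<mu>"] card_\<mu> \<open>0 \<notin> \<mu>\<close> by force
    hence "card {y. w y \<noteq> 0} \<le> k"
      by (simp add: card_Collect_option w(1,2) kt)
    moreover have "(\<Sum>y\<in>UNIV. col (monom 1 j) y * w y) = 0" if "j < k" for j
    proof -
      have "(\<Sum>a\<in>UNIV. a ^ j * (if a \<in> \<mu> then 1 else 0)) = (\<Sum>a\<in>\<mu>. a ^ j)"
        by (rule sum.mono_neutral_cong_right) auto
      moreover have "(\<Sum>a\<in>UNIV. a ^ j * (if a = 0 then - of_nat t else 0))
                       = (if j = 0 then - of_nat t else (0::'a))"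
        by (simp add: if_distrib power_0_left cong: if_cong)
      moreover have "t dvd j \<longleftrightarrow> j = 0 \<or> j = t"
      proof
        assume "t dvd j"
        then obtain c where c: "j = t * c"
          by (auto elim: dvdE)
        have "t * c < t * 2"
          unfolding c[symmetric] using that t2 kt(1) by simp
        hence "c < 2"
          unfolding mult_less_cancel1 by blast
        thus "j = 0 \<or> j = t"
          using c by (cases "c = 0") auto
      qed auto
      ultimately show ?thesis
        using t2 by (simp add: sum_UNIV_option w poly_monom kt(2,3) ring_distribs sum.distrib sum_\<mu> del: One_nat_def)
    qed
    \<comment> \<open>Now the tangent coordinate cancels the power sum at j = t. The rows j = t + 1
      and j = t - Q both carry g_{t+1}^Q up to sign, so the omitted exponent is k - 1.\<close>
    moreover have "vec.dim (galois_hull p l C) = k - 1"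
    proof (rule dim_galois_hull)
      show "k - 1 < k"
        using three_le_k by simp
      fix g :: "'a poly" assume g: "\<And>i. i \<ge> k \<Longrightarrow> coeff g i = 0"
      have "(\<Sum>i\<in>UNIV. enc (monom 1 j) $ i * enc g $ i ^ p ^ l)
              = (if j = t + 1 then coeff g (t + 1) ^ p ^ l else 0)
                + (if j = t - Q then - (coeff g (t + 1) ^ p ^ l) else 0)" if "j < k" for j
      proof -
        have "(\<Sum>i<k. if 0 < j + i * p ^ l \<and> (CARD('a) - 1) dvd (j + i * p ^ l)
                 then - (coeff g i ^ p ^ l) else 0)
              = (\<Sum>i<k. (if i = t then (if j = t then - (coeff g t ^ p ^ l) else 0) else 0)
                  + (if i = t + 1 then (if j = t - Q then - (coeff g (t + 1) ^ p ^ l) else 0) else 0))"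
        proof (rule sum.cong)
          fix i assume "i \<in> {..<k}"
          hence "0 < j + i * p ^ l \<and> (CARD('a) - 1) dvd (j + i * p ^ l)
                  \<longleftrightarrow> i = t \<and> j = t \<or> i = t + 1 \<and> j = t - Q"
            unfolding CARD_tQ Q_def using that kt(1) Qt Q2
            by (intro exponent_eq_iff_1) (auto simp: Q_def)
          thus "(if 0 < j + i * p ^ l \<and> (CARD('a) - 1) dvd (j + i * p ^ l)
                 then - (coeff g i ^ p ^ l) else 0)
              = (if i = t then (if j = t then - (coeff g t ^ p ^ l) else 0) else 0)
                  + (if i = t + 1 then (if j = t - Q then - (coeff g (t + 1) ^ p ^ l) else 0) else 0)"
            by auto
        qed simp
        also have "\<dots> = (if j = t then - (coeff g t ^ p ^ l) else 0)
            + (if j = t - Q then - (coeff g (t + 1) ^ p ^ l) else 0)"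
          unfolding sum.distrib using kt(1) by simp
        finally show ?thesis
          using gram_monom[OF assms(1) assms(4)[unfolded assms(2)] g, where j = j and l = l]
          unfolding kt(2,3) by simp
      qed
      moreover have "t + 1 < k"
        using kt(1) by simp
      ultimately show "(\<forall>j<k. (\<Sum>i\<in>UNIV. enc (monom 1 j) $ i * enc g $ i ^ p ^ l) = 0)
              \<longleftrightarrow> coeff g (k - 1) = 0"
        using \<open>t + 1 < k\<close> prime_gt_0_nat[OF assms(1)] unfolding kt(2,3) by auto
    qed
    ultimately show ?thesis
      using t_nz w(1) by (intro conjI exI[of _ f] exI[of _ w]) auto
  qed
  then obtain f w where "f \<noteq> 0" "degree f < k" "k \<le> card {y. col f y = 0}"
    "w None \<noteq> 0" "card {y. w y \<noteq> 0} \<le> k"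
    "\<And>j. j < k \<Longrightarrow> (\<Sum>y\<in>UNIV. col (monom 1 j) y * w y) = 0"
    and hull: "vec.dim (galois_hull p l C) = k - 1"
    by blast
  from NMDS_code[OF this(1-6)] hull show ?thesis
    unfolding assms(4) NMDS_def by blast
qed

end
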